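(* Let $(E,\|\cdot\|)$ be a real Banach space, $r\in(0,\infty)$, and let $X$ be a Radon $E$-valued random variable on a probability space $(\Omega,\mathcal A,\mathbb P)$ with $\mathbb E\|X\|^r<\infty$. Assume that $\mathbb P_X(F)=1$ for some Banach subspace $F$ of $E$ and that the pair $(F,E)$ is admissible. Then, for every $n\in\mathbb N$, $$\mathcal C_{n,r}(X,E)\neq\emptyset .$$
   Context: $\mathbb N=\{1,2,\dots\}$. $\mathbb P_X$ denotes the distribution of $X$. An $E$-valued random variable $X$ is Radon if it is Borel measurable and $\mathbb P_X$ is a Radon probability measure on $E$ (inner regular with respect to compact sets; equivalently tight). For $n\in\mathbb N$ let $$e_{n,r}(X,E):=\inf\Big\{\big(\mathbb E\min_{a\in\alpha}\|X-a\|^r\big)^{1/r}:\alpha\subset E,\ 1\le\mathrm{card}(\alpha)\le n\Big\}.$$ $\mathcal C_{n,r}(X,E)$ is the set of all $L^r$-optimal $n$-quantizers, i.e. of all $\alpha\subset E$ with $1\le\mathrm{card}(\alpha)\le n$ and $(\mathbb E\min_{a\in\alpha}\|X-a\|^r)^{1/r}=e_{n,r}(X,E)$. A Banach subspace is a closed linear subspace with the induced norm. For $x\in E$, $\rho>0$ let $B_E(x,\rho)=\{y\in E:\|y-x\|\le\rho\}$. A system $\mathcal K$ of subsets of $E$ is compact if every subsystem $\mathcal K_0$ of $\mathcal K$ with the finite intersection property (every finite subsystem of $\mathcal K_0$ has nonempty intersection) has nonempty intersection. For a Banach subspace $F$ of $E$, the pair $(F,E)$ is admissible if $\{B_E(x,\rho):x\in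 F,\rho>0\}$ is a compact system in $E$. *)

theory Defs
  imports "HOL-Probability.Probability"
begin

text \<open>The Banach space \<open>E\<close> is a type of class \<^class>\<open>banach\<close>.\<close>

definition radon_prob :: "'a::topological_space measure \<Rightarrow> bool" where
  "radon_prob \<mu> \<longleftrightarrow> prob_space \<mu> \<and> sets \<mu> = sets borel \<and>
     (\<forall>A\<in>sets borel. emeasure \<mu> A = (SUP K\<in>{K. compact K \<and> K \<in> sets borel \<and> K \<subseteq> A}. emeasure \<mu> K))"

definition radon_random_variable :: "'w measure \<Rightarrow> ('w \<Rightarrow> 'a::topological_space) \<Rightarrow> bool" where
  "radon_random_variable M X \<longleftrightarrow> X \<in> borel_measurable M \<and> radon_prob (distr M borel X)"

text \<open>The Bochner integral gives the intended expectation when \<open>norm X powr r\<close> is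
  integrable and \<open>\<alpha>\<close> is finite and nonempty; otherwise the value is not meaningful.\<close>

definition quant_err :: "real \<Rightarrow> 'w measure \<Rightarrow> ('w \<Rightarrow> 'a::real_normed_vector) \<Rightarrow> 'a set \<Rightarrow> real" where
  "quant_err r M X \<alpha> =
     (\<integral>\<omega>. Min ((\<lambda>a. norm (X \<omega> - a) powr r) ` \<alpha>) \<partial>M) powr (1 / r)"

text \<open>Since infinite sets have cardinality 0, \<open>1 \<le> card \<alpha>\<close> entails finiteness.\<close>

definition opt_quant_err :: "nat \<Rightarrow> real \<Rightarrow> 'w measure \<Rightarrow> ('w \<Rightarrow> 'a::real_normed_vector) \<Rightarrow> real" where
  "opt_quant_err n r M X = Inf {quant_err r M X \<alpha> | \<alpha>. 1 \<le> card \<alpha> \<and> card \<alpha> \<le> n}"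

definition opt_quantizers :: "nat \<Rightarrow> real \<Rightarrow> 'w measure \<Rightarrow> ('w \<Rightarrow> 'a::real_normed_vector) \<Rightarrow> 'a set set" where
  "opt_quantizers n r M X =
     {\<alpha>. 1 \<le> card \<alpha> \<and> card \<alpha> \<le> n \<and> quant_err r M X \<alpha> = opt_quant_err n r M X}"

definition banach_subspace :: "'a::banach set \<Rightarrow> bool" where
  "banach_subspace F \<longleftrightarrow> subspace F \<and> closed F"

definition compact_system :: "'a set set \<Rightarrow> bool" where
  "compact_system \<K> \<longleftrightarrow>
     (\<forall>\<K>0\<subseteq>\<K>. (\<forall>\<F>\<subseteq>\<K>0. finite \<F> \<longrightarrow> \<Inter>\<F> \<noteq> {}) \<longrightarrow> \<Inter>\<K>0 \<noteq> {})"

definition admissible :: "'a::banach set \<Rightarrow> bool" where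
  "admissible F \<longleftrightarrow> compact_system {cball x \<rho> | x \<rho>. x \<in> F \<and> 0 < \<rho>}"

end

theory Submission
  imports Defs "HOL-Complex_Analysis.Great_Picard"
begin

text \<open>
  The proof is the direct method: along a sequence of quantizers whose errors tend to the
  optimal error, a limiting quantizer is extracted whose error is no larger.  The points of the
  quantizers need not have a norm-convergent subsequence, and some may even run off to infinity.  What is needed of a limit \<open>a\<close> of points \<open>b k\<close> is only
  \<open>norm (x - a) \<le> liminf norm (x - b k)\<close> for almost all values \<open>x\<close> of \<open>X\<close>; taking minima over
  the finitely many points and applying Fatou's lemma then gives the semicontinuity of the error.

  The Radon property makes it possible to work with sequences instead of ultrafilters.  It supplies
  a countable \<open>D \<subseteq> F\<close> whose closure contains almost all values of \<open>X\<close>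
  (\<open>radon_prob_countable_dense\<close>), so a diagonal subsequence makes all distances
  \<open>norm (x - b k)\<close> with \<open>x \<in> D\<close> converge in \<open>[0, \<infinity>]\<close>.  The balls around points of \<open>D\<close>
  that eventually contain \<open>b k\<close> then have the finite intersection property, because finitely many
  of them share some \<open>b k\<close>; admissibility provides a point \<open>a\<close> in all of them
  (\<open>admissible_dominated_limit\<close>).  This point satisfies the required inequality on \<open>D\<close>, and on its
  closure since distances are continuous.  Points that escape to infinity cause no trouble: then no
  ball qualifies, any \<open>a\<close> will do, and the inequality holds because its right-hand side is
  infinite.
\<close>

section \<open>A countable set whose closure carries a Radon measure\<close>

lemma compact_subset_closure_countable:
  fixes K :: "'a::metric_space set"
  assumes "compact K"
  obtains D where "countable D" "D \<subseteq> K" "K \<subseteq> closure D"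
proof -
  have "\<exists>T. finite T \<and> T \<subseteq> K \<and> K \<subseteq> (\<Union>x\<in>T. ball x (1 / real (Suc m)))" for m
    using seq_compact_imp_totally_bounded[OF compact_imp_seq_compact[OF assms]] by simp
  then obtain T where T: "\<And>m. finite (T m)" "\<And>m. T m \<subseteq> K"
      "\<And>m. K \<subseteq> (\<Union>x\<in>T m. ball x (1 / real (Suc m)))"
    by metis
  show thesis
  proof
    show "countable (\<Union>m. T m)"
      using T(1) by (auto intro: countable_finite)
    show "(\<Union>m. T m) \<subseteq> K"
      using T(2) by blast
    show "K \<subseteq> closure (\<Union>m. T m)"
    proof
      fix x assume x: "x \<in> K"
      show "x \<in> closure (\<Union>m. T m)"
        unfolding closure_approachable
      proof (intro allI impI)
        fix e :: real assume "0 < e"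
        then obtain m where m: "1 / real (Suc m) < e"
          using nat_approx_posE by blast
        from T(3)[of m] x obtain y where "y \<in> T m" "dist y x < 1 / real (Suc m)"
          by auto
        with m show "\<exists>y\<in>(\<Union>m. T m). dist y x < e"
          by (intro bexI[of _ y]) auto
      qed
    qed
  qed
qed

text \<open>Compact sets are separable, and inner regularity exhausts \<open>F\<close> up to a null set by countably
  many compact sets.  So the distribution lives on a separable part of \<open>F\<close> even when \<open>F\<close> itself is
  not separable.\<close>

lemma radon_prob_countable_dense:
  fixes \<mu> :: "'a::metric_space measure"
  assumes "radon_prob \<mu>" "closed F" "measure \<mu> F = 1"
  obtains D where "countable D" "D \<subseteq> F" "AE x in \<mu>. x \<in> closure D"
proof -
  interpret prob_space \<mu>
    using assms(1) by (simp add: radon_prob_def)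
  have sets_\<mu>: "sets \<mu> = sets borel"
    using assms(1) by (simp add: radon_prob_def)
  define \<C> where "\<C> = {K. compact K \<and> K \<in> sets borel \<and> K \<subseteq> F}"
  have "F \<in> sets borel"
    using assms(2) by simp
  then have "(SUP K\<in>\<C>. emeasure \<mu> K) = emeasure \<mu> F"
    using assms(1) by (simp add: radon_prob_def \<C>_def)
  then have sup1: "(SUP K\<in>\<C>. emeasure \<mu> K) = 1"
    using assms(3) by (simp add: emeasure_eq_measure)
  have "{} \<in> \<C>"
    by (simp add: \<C>_def)
  then have "\<C> \<noteq> {}"
    by blast
  from ennreal_SUP_countable_SUP[OF this, of "emeasure \<mu>"]
  obtain f :: "nat \<Rightarrow> ennreal" where f: "range f \<subseteq> emeasure \<mu> ` \<C>" "(SUP i. f i) = 1"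
    using sup1 by auto
  have "\<forall>i. \<exists>K\<in>\<C>. f i = emeasure \<mu> K"
    using f(1) by blast
  then obtain K where K: "\<And>i. K i \<in> \<C>" "\<And>i. f i = emeasure \<mu> (K i)"
    by metis
  have "\<exists>D. countable D \<and> D \<subseteq> K i \<and> K i \<subseteq> closure D" for i
  proof -
    have "compact (K i)"
      using K(1)[of i] by (simp add: \<C>_def)
    from compact_subset_closure_countable[OF this] show ?thesis
      by metis
  qed
  then obtain D where D: "\<And>i. countable (D i)" "\<And>i. D i \<subseteq> K i" "\<And>i. K i \<subseteq> closure (D i)"
    by metis
  let ?D = "\<Union>i. D i"
  show thesis
  proof
    show "countable ?D"
      using D(1) by auto
    show "?D \<subseteq> F"
      using D(2) K(1) by (fastforce simp: \<C>_def)
    have cl: "closure ?D \<in> sets \<mu>"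
      by (simp add: sets_\<mu>)
    have "f i \<le> emeasure \<mu> (closure ?D)" for i
    proof -
      have "K i \<subseteq> closure ?D"
        using D(3)[of i] closure_mono[of "D i" ?D] UN_upper[of i UNIV D] by simp
      then show ?thesis
        using K(2) cl by (simp add: emeasure_mono)
    qed
    then have "1 \<le> emeasure \<mu> (closure ?D)"
      using f(2) SUP_least[of UNIV f] by metis
    then have "1 \<le> prob (closure ?D)"
      by (simp add: emeasure_eq_measure)
    then have "prob (closure ?D) = 1"
      using prob_le_1[of "closure ?D"] by linarith
    then show "AE x in \<mu>. x \<in> closure ?D"
      using prob_eq_1[OF cl] by simp
  qed
qed

section \<open>Limits of sequences of centres in an admissible pair\<close>

text \<open>This is \<open>norm (x - a) \<le> liminf norm (x - b k)\<close>, phrased without extended reals.  If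
  \<open>b k\<close> tends to infinity in norm, the premise is never satisfied and every \<open>a\<close> qualifies.\<close>

definition dominated_limit :: "(nat \<Rightarrow> 'a::real_normed_vector) \<Rightarrow> 'a \<Rightarrow> 'a \<Rightarrow> bool" where
  "dominated_limit b a x \<longleftrightarrow>
     (\<forall>c. (\<exists>\<^sub>F k in sequentially. norm (x - b k) < c) \<longrightarrow> norm (x - a) \<le> c)"

text \<open>Both \<open>norm (x - a)\<close> and \<open>liminf norm (x - b k)\<close> are 1-Lipschitz in \<open>x\<close>, so an inequality
  between them extends to the closure.\<close>

lemma dominated_limit_closure:
  assumes "\<And>x. x \<in> D \<Longrightarrow> dominated_limit b a x" "x \<in> closure D"
  shows "dominated_limit b a x"
  unfolding dominated_limit_def
proof (intro allI impI)
  fix c assume freq: "\<exists>\<^sub>F k in sequentially. norm (x - b k) < c"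
  show "norm (x - a) \<le> c"
  proof (rule field_le_epsilon)
    fix e :: real assume "0 < e"
    then obtain y where y: "y \<in> D" "norm (y - x) < e / 2"
      using assms(2) unfolding closure_approachable dist_norm by (meson half_gt_zero)
    have "\<exists>\<^sub>F k in sequentially. norm (y - b k) < c + e / 2"
      using freq
    proof (rule frequently_elim1)
      fix k assume "norm (x - b k) < c"
      with y(2) norm_triangle_ineq[of "y - x" "x - b k"]
      show "norm (y - b k) < c + e / 2" by simp
    qed
    then have "norm (y - a) \<le> c + e / 2"
      using assms(1)[OF y(1)] by (simp add: dominated_limit_def)
    with y(2) norm_triangle_ineq[of "x - y" "y - a"] show "norm (x - a) \<le> c + e"
      by (simp add: norm_minus_commute)
  qed
qed

text \<open>The map \<open>t \<mapsto> 1 / (1 + t)\<close> is a decreasing homeomorphism from \<open>[0, \<infinity>]\<close> onto \<open>[0, 1]\<close>, so the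
  hypothesis is that \<open>d\<close> converges in \<open>[0, \<infinity>]\<close>.  This form gives bounded real sequences, to which
  the diagonal argument applies without separating bounded from unbounded distances.\<close>

lemma convergent_inverse_frequently_less:
  fixes d :: "nat \<Rightarrow> real"
  assumes nonneg: "\<And>k. 0 \<le> d k" and "convergent (\<lambda>k. 1 / (1 + d k))"
    and freq: "\<exists>\<^sub>F k in sequentially. d k < c" and "c < c'"
  shows "\<forall>\<^sub>F k in sequentially. d k < c'"
proof -
  obtain l where l: "(\<lambda>k. 1 / (1 + d k)) \<longlonglongrightarrow> l"
    using assms(2) by (auto simp: convergent_def)
  from freq obtain k where "d k < c"
    by (auto dest: frequently_ex)
  then have "0 < c"
    using nonneg[of k] by linarith
  have "1 / (1 + c) \<le> l"
  proof (rule ccontr)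
    assume "\<not> 1 / (1 + c) \<le> l"
    then have "\<forall>\<^sub>F k in sequentially. 1 / (1 + d k) < 1 / (1 + c)"
      using order_tendstoD(2)[OF l] by simp
    then have "\<forall>\<^sub>F k in sequentially. \<not> d k < c"
    proof (rule eventually_mono)
      fix k assume "1 / (1 + d k) < 1 / (1 + c)"
      with nonneg[of k] \<open>0 < c\<close> show "\<not> d k < c"
        by (simp add: field_simps)
    qed
    with freq show False
      by (simp add: frequently_def)
  qed
  moreover have "1 / (1 + c') < 1 / (1 + c)"
    using \<open>0 < c\<close> \<open>c < c'\<close> by (simp add: field_simps)
  ultimately have "\<forall>\<^sub>F k in sequentially. 1 / (1 + c') < 1 / (1 + d k)"
    using order_tendstoD(1)[OF l] by simp
  then show ?thesis
  proof (rule eventually_mono)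
    fix k assume "1 / (1 + c') < 1 / (1 + d k)"
    with nonneg[of k] \<open>0 < c\<close> \<open>c < c'\<close> show "d k < c'"
      by (simp add: field_simps)
  qed
qed

text \<open>The compact system is applied to the balls with centre in \<open>D\<close> that eventually contain \<open>b k\<close>.
  Convergence of the distances is what turns ``frequently in a ball'' into ``eventually in every
  larger concentric ball'', so that these balls are small enough to bound the distances to \<open>a\<close> by
  the inferior limits.\<close>

lemma admissible_dominated_limit:
  fixes b :: "nat \<Rightarrow> 'a::banach"
  assumes "admissible F" "D \<subseteq> F"
    and conv: "\<And>x. x \<in> D \<Longrightarrow> convergent (\<lambda>k. 1 / (1 + norm (x - b k)))"
  obtains a where "\<And>x. x \<in> closure D \<Longrightarrow> dominated_limit b a x"
proof -
  define \<K> where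
    "\<K> = {cball x \<rho> | x \<rho>. x \<in> D \<and> 0 < \<rho> \<and> (\<forall>\<^sub>F k in sequentially. b k \<in> cball x \<rho>)}"
  have "\<Inter>\<F> \<noteq> {}" if "\<F> \<subseteq> \<K>" "finite \<F>" for \<F>
  proof -
    have "\<forall>S\<in>\<F>. \<forall>\<^sub>F k in sequentially. b k \<in> S"
      using that(1) by (auto simp: \<K>_def)
    then have "\<forall>\<^sub>F k in sequentially. \<forall>S\<in>\<F>. b k \<in> S"
      using that(2) by (simp add: eventually_ball_finite)
    then obtain k where "\<forall>S\<in>\<F>. b k \<in> S"
      using eventually_happens'[OF sequentially_bot] by blast
    then show ?thesis by blast
  qed
  moreover have "\<K> \<subseteq> {cball x \<rho> | x \<rho>. x \<in> F \<and> 0 < \<rho>}"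
    using assms(2) by (auto simp: \<K>_def)
  ultimately have "\<Inter>\<K> \<noteq> {}"
    using assms(1) unfolding admissible_def compact_system_def by simp
  then obtain a where a: "a \<in> \<Inter>\<K>" by blast
  have "dominated_limit b a x" if x: "x \<in> D" for x
    unfolding dominated_limit_def
  proof (intro allI impI)
    fix c assume freq: "\<exists>\<^sub>F k in sequentially. norm (x - b k) < c"
    then obtain k where "norm (x - b k) < c"
      by (auto dest: frequently_ex)
    then have "0 < c"
      using norm_ge_zero[of "x - b k"] by linarith
    show "norm (x - a) \<le> c"
    proof (rule field_le_epsilon)
      fix e :: real assume "0 < e"
      then have "\<forall>\<^sub>F k in sequentially. norm (x - b k) < c + e"
        using convergent_inverse_frequently_less[OF _ conv[OF x] freq] by simp
      then have "\<forall>\<^sub>F k in sequentially. b k \<in> cball x (c + e)"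
        by (rule eventually_mono) (simp add: dist_norm)
      with x \<open>0 < c\<close> \<open>0 < e\<close> have "cball x (c + e) \<in> \<K>"
        unfolding \<K>_def by force
      with a have "a \<in> cball x (c + e)" by blast
      then show "norm (x - a) \<le> c + e"
        by (simp add: dist_norm)
    qed
  qed
  then show thesis
    using that dominated_limit_closure by blast
qed

text \<open>One subsequence serves all indices \<open>i\<close>, since the diagonal argument runs over the countable set
  of pairs of an index and a point of \<open>D\<close>.\<close>

lemma admissible_subseq_dominated_limits:
  fixes a :: "nat \<Rightarrow> nat \<Rightarrow> 'a::banach"
  assumes "admissible F" "D \<subseteq> F" "countable D"
  obtains s b where "strict_mono s"
    "\<And>i x. x \<in> closure D \<Longrightarrow> dominated_limit (\<lambda>k. a (s k) i) (b i) x"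
proof -
  define f where "f = (\<lambda>k (i, x). 1 / (1 + norm (x - a k i)))"
  have "norm (f k p) \<le> 1" for k p
    by (cases p) (simp add: f_def add_pos_nonneg)
  moreover have "countable ((UNIV :: nat set) \<times> D)"
    using assms(3) by simp
  ultimately obtain s where s: "strict_mono (s :: nat \<Rightarrow> nat)"
      "\<And>p. p \<in> UNIV \<times> D \<Longrightarrow> \<exists>l. (\<lambda>k. f (s k) p) \<longlonglongrightarrow> l"
    using function_convergent_subsequence[of "UNIV \<times> D" f 1] by blast
  have "convergent (\<lambda>k. 1 / (1 + norm (x - a (s k) i)))" if "x \<in> D" for i x
    using s(2)[of "(i, x)"] that by (simp add: f_def convergent_def)
  then have "\<exists>c. \<forall>x\<in>closure D. dominated_limit (\<lambda>k. a (s k) i) c x" for i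
    by (metis admissible_dominated_limit[OF assms(1,2)])
  then obtain b where "\<And>i. \<forall>x\<in>closure D. dominated_limit (\<lambda>k. a (s k) i) (b i) x"
    by metis
  with s(1) that show thesis by blast
qed

section \<open>The distortion of a finite quantizer\<close>

definition distortion :: "real \<Rightarrow> 'a::real_normed_vector set \<Rightarrow> 'a \<Rightarrow> real" where
  "distortion r \<alpha> x = Min ((\<lambda>a. norm (x - a) powr r) ` \<alpha>)"

lemma quant_err_eq: "quant_err r M X \<alpha> = (\<integral>\<omega>. distortion r \<alpha> (X \<omega>) \<partial>M) powr (1 / r)"
  by (simp add: quant_err_def distortion_def)

lemma distortion_nonneg: "finite \<alpha> \<Longrightarrow> \<alpha> \<noteq> {} \<Longrightarrow> 0 \<le> distortion r \<alpha> x"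
  by (simp add: distortion_def)

lemma distortion_measurable:
  assumes "finite \<alpha>" "X \<in> borel_measurable M"
  shows "(\<lambda>\<omega>. distortion r \<alpha> (X \<omega>)) \<in> borel_measurable M"
proof -
  have "(\<lambda>\<omega>. norm (X \<omega> - a)) \<in> borel_measurable M" for a
    by (rule borel_measurable_continuous_on[OF _ assms(2)]) (intro continuous_intros)
  then show ?thesis
    unfolding distortion_def using assms(1) by (intro borel_measurable_Min) auto
qed

text \<open>A substitute for the triangle inequality that covers exponents below and above 1 alike.\<close>

lemma norm_diff_powr_le:
  fixes x a :: "'a::real_normed_vector"
  assumes "0 < r"
  shows "norm (x - a) powr r \<le> 2 powr r * (norm x powr r + norm a powr r)"
proof -
  have "norm (x - a) \<le> 2 * max (norm x) (norm a)"
    using norm_triangle_ineq4[of x a] by simp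
  then have "norm (x - a) powr r \<le> (2 * max (norm x) (norm a)) powr r"
    using assms by (intro powr_mono2) auto
  also have "\<dots> = 2 powr r * (max (norm x) (norm a)) powr r"
    by (simp add: powr_mult le_max_iff_disj)
  also have "\<dots> \<le> 2 powr r * (norm x powr r + norm a powr r)"
    by (intro mult_left_mono) (auto simp: max_def)
  finally show ?thesis .
qed

lemma distortion_integrable:
  assumes "prob_space M" "0 < r" "X \<in> borel_measurable M"
    and "integrable M (\<lambda>\<omega>. norm (X \<omega>) powr r)" "finite \<alpha>" "\<alpha> \<noteq> {}"
  shows "integrable M (\<lambda>\<omega>. distortion r \<alpha> (X \<omega>))"
proof -
  interpret prob_space M by fact
  obtain a where a: "a \<in> \<alpha>" using assms(6) by blast
  show ?thesis
  proof (rule Bochner_Integration.integrable_bound)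
    show "integrable M (\<lambda>\<omega>. 2 powr r * (norm (X \<omega>) powr r + norm a powr r))"
      using assms(4) by simp
    show "AE \<omega> in M. norm (distortion r \<alpha> (X \<omega>))
            \<le> norm (2 powr r * (norm (X \<omega>) powr r + norm a powr r))"
    proof (intro always_eventually allI)
      fix \<omega>
      have "distortion r \<alpha> (X \<omega>) \<le> norm (X \<omega> - a) powr r"
        unfolding distortion_def using assms(5) a by (intro Min_le) auto
      also note norm_diff_powr_le[OF assms(2)]
      finally show "norm (distortion r \<alpha> (X \<omega>))
            \<le> norm (2 powr r * (norm (X \<omega>) powr r + norm a powr r))"
        using distortion_nonneg[OF assms(5,6)] by simp
    qed
  qed (rule distortion_measurable[OF assms(5,3)])
qed

lemma distortion_less_iff:
  assumes "finite \<alpha>" "\<alpha> \<noteq> {}"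
  shows "distortion r \<alpha> x < c \<longleftrightarrow> (\<exists>a\<in>\<alpha>. norm (x - a) powr r < c)"
  using assms by (simp add: distortion_def Min_less_iff)

text \<open>Only finitely many points compete for the minimum, so if the minimal distance is frequently
  small, a single index attains a small distance frequently, and the bound on
  \<open>norm (x - b i)\<close> applies to that index.\<close>

lemma distortion_le_liminf:
  fixes a :: "nat \<Rightarrow> 'i \<Rightarrow> 'a::real_normed_vector"
  assumes "0 < r" "finite I" "I \<noteq> {}"
    and dom: "\<And>i. i \<in> I \<Longrightarrow> dominated_limit (\<lambda>k. a k i) (b i) x"
  shows "ennreal (distortion r (b ` I) x)
           \<le> liminf (\<lambda>k. ennreal (distortion r (a k ` I) x))"
proof (rule ccontr)
  have fin: "finite (f ` I)" and ne: "f ` I \<noteq> {}" for f :: "'i \<Rightarrow> 'a"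
    using assms(2,3) by simp_all
  let ?d = "distortion r (b ` I) x"
  assume "\<not> ?thesis"
  then obtain y where y: "y < ennreal ?d"
      "\<not> (\<forall>\<^sub>F k in sequentially. y < ennreal (distortion r (a k ` I) x))"
    unfolding le_Liminf_iff by blast
  \<comment> \<open>Strict room between \<open>y\<close> and the distortion turns the non-strict bound on the distances
    to the points \<open>b i\<close> into a contradiction.\<close>
  obtain t where t: "y = ennreal t" "0 \<le> t" "t < ?d"
    using y(1) by (cases y) (auto simp: ennreal_less_iff)
  then obtain u where u: "t < u" "u < ?d"
    using dense by blast
  have "\<exists>\<^sub>F k in sequentially. \<exists>i\<in>I. norm (x - a k i) < u powr (1 / r)"
    using y(2) unfolding not_eventually
  proof (rule frequently_elim1)
    fix k assume "\<not> y < ennreal (distortion r (a k ` I) x)"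
    then have "distortion r (a k ` I) x \<le> t"
      using t(1,2) by (simp add: not_less)
    then have "distortion r (a k ` I) x < u"
      using u(1) by simp
    then obtain i where i: "i \<in> I" "norm (x - a k i) powr r < u"
      using distortion_less_iff[OF fin ne] by auto
    then have "(norm (x - a k i) powr r) powr (1 / r) < u powr (1 / r)"
      using assms(1) by (intro powr_less_mono2) auto
    with i(1) show "\<exists>i\<in>I. norm (x - a k i) < u powr (1 / r)"
      using assms(1) by (auto simp: powr_powr)
  qed
  from frequently_bex_finite[OF assms(2) this]
  obtain i where i: "i \<in> I" "\<exists>\<^sub>F k in sequentially. norm (x - a k i) < u powr (1 / r)" ..
  then have "norm (x - b i) \<le> u powr (1 / r)"
    using dom[OF i(1)] by (simp add: dominated_limit_def)
  then have "norm (x - b i) powr r \<le> (u powr (1 / r)) powr r"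
    using assms(1) by (intro powr_mono2) auto
  also have "\<dots> = u"
    using assms(1) t(2) u(1) by (simp add: powr_powr)
  also note u(2)
  finally have "norm (x - b i) powr r < ?d" .
  moreover have "?d \<le> norm (x - b i) powr r"
    unfolding distortion_def using fin i(1) by (intro Min_le) auto
  ultimately show False by simp
qed

text \<open>Repetitions are allowed, so all quantizers of a minimizing sequence are indexed by the same
  set even when their cardinalities vary.\<close>

lemma image_lessThan_enumeration:
  assumes "1 \<le> card \<alpha>" "card \<alpha> \<le> n"
  obtains a :: "nat \<Rightarrow> 'a" where "a ` {..<n} = \<alpha>"
proof -
  have fin: "finite \<alpha>" and "\<alpha> \<noteq> {}"
    using assms(1) card.infinite by force+
  then obtain z where z: "z \<in> \<alpha>" by blast
  obtain h where h: "bij_betw h {..<card \<alpha>} \<alpha>"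
    using ex_bij_betw_nat_finite[OF fin] by (auto simp: atLeast0LessThan)
  then have im: "h ` {..<card \<alpha>} = \<alpha>" by (simp add: bij_betw_def)
  have "(\<lambda>i. if i < card \<alpha> then h i else z) ` {..<n} = \<alpha>"
    using im z assms(2) by (fastforce simp: image_iff)
  then show thesis by (rule that)
qed

section \<open>Existence of optimal quantizers\<close>

text \<open>The pointwise semicontinuity of the distortion passes to the expectation by Fatou's lemma.\<close>

lemma exists_dominating_quantizer:
  fixes X :: "'w \<Rightarrow> 'a::banach" and a :: "nat \<Rightarrow> nat \<Rightarrow> 'a"
  assumes "prob_space M" "0 < r" "X \<in> borel_measurable M"
    and int: "integrable M (\<lambda>\<omega>. norm (X \<omega>) powr r)"
    and "admissible F" "D \<subseteq> F" "countable D" "AE \<omega> in M. X \<omega> \<in> closure D"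
    and "1 \<le> n" and lim: "(\<lambda>k. quant_err r M X (a k ` {..<n})) \<longlonglongrightarrow> e"
  obtains b where "quant_err r M X (b ` {..<n}) \<le> e"
proof -
  let ?I = "{..<n}"
  have ne: "?I \<noteq> {}"
    using assms(9) by (simp add: lessThan_empty_iff)
  obtain s b where s: "strict_mono s"
    and b: "\<And>i x. x \<in> closure D \<Longrightarrow> dominated_limit (\<lambda>k. a (s k) i) (b i) x"
    by (rule admissible_subseq_dominated_limits[OF assms(5,6,7), where a = a]) blast
  let ?c = "\<lambda>h. \<integral>\<omega>. distortion r (h ` ?I) (X \<omega>) \<partial>M"
  have c_nonneg: "0 \<le> ?c h" for h
    using ne by (intro integral_nonneg_AE always_eventually allI distortion_nonneg) auto
  have nn: "(\<integral>\<^sup>+\<omega>. ennreal (distortion r (h ` ?I) (X \<omega>)) \<partial>M) = ennreal (?c h)" for h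
    using ne by (intro nn_integral_eq_integral distortion_integrable[OF assms(1-3) int]
        always_eventually allI distortion_nonneg) auto
  have root: "(quant_err r M X (h ` ?I)) powr r = ?c h" for h
    using assms(2) c_nonneg[of h] by (simp add: quant_err_eq powr_powr)
  have "0 \<le> e"
    using lim by (rule LIMSEQ_le_const) (simp add: quant_err_eq)
  have "(\<lambda>k. quant_err r M X (a (s k) ` ?I)) \<longlonglongrightarrow> e"
    using LIMSEQ_subseq_LIMSEQ[OF lim s] by (simp add: o_def)
  then have "(\<lambda>k. quant_err r M X (a (s k) ` ?I) powr r) \<longlonglongrightarrow> e powr r"
    using assms(2) by (intro tendsto_powr' tendsto_const) (auto simp: quant_err_eq)
  then have lim_c: "(\<lambda>k. ennreal (?c (a (s k)))) \<longlonglongrightarrow> ennreal (e powr r)"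
    unfolding root by (rule tendsto_ennrealI)
  have "ennreal (?c b) = (\<integral>\<^sup>+\<omega>. ennreal (distortion r (b ` ?I) (X \<omega>)) \<partial>M)"
    by (rule nn[symmetric])
  also have "\<dots> \<le> (\<integral>\<^sup>+\<omega>. liminf (\<lambda>k. ennreal (distortion r (a (s k) ` ?I) (X \<omega>))) \<partial>M)"
  proof (rule nn_integral_mono_AE)
    show "AE \<omega> in M. ennreal (distortion r (b ` ?I) (X \<omega>))
        \<le> liminf (\<lambda>k. ennreal (distortion r (a (s k) ` ?I) (X \<omega>)))"
      using assms(8)
    proof (rule AE_mp, intro always_eventually allI impI)
      fix \<omega> assume "X \<omega> \<in> closure D"
      then show "ennreal (distortion r (b ` ?I) (X \<omega>))
          \<le> liminf (\<lambda>k. ennreal (distortion r (a (s k) ` ?I) (X \<omega>)))"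
        using b ne by (intro distortion_le_liminf[OF assms(2)]) auto
    qed
  qed
  also have "\<dots> \<le> liminf (\<lambda>k. \<integral>\<^sup>+\<omega>. ennreal (distortion r (a (s k) ` ?I) (X \<omega>)) \<partial>M)"
    by (intro nn_integral_liminf measurable_compose[OF _ measurable_ennreal]
        distortion_measurable assms(3)) auto
  also have "\<dots> = ennreal (e powr r)"
    unfolding nn using lim_imp_Liminf[OF _ lim_c] by simp
  finally have "?c b \<le> e powr r"
    by simp
  then have "(?c b) powr (1 / r) \<le> (e powr r) powr (1 / r)"
    using assms(2) c_nonneg by (intro powr_mono2) auto
  then have "quant_err r M X (b ` ?I) \<le> e"
    using assms(2) \<open>0 \<le> e\<close> by (simp add: quant_err_eq powr_powr)
  then show thesis by (rule that)
qed

theorem theorem1: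
  fixes M :: "'w measure" and X :: "'w \<Rightarrow> 'a::banach" and F :: "'a set"
    and r :: real and n :: nat
  assumes "prob_space M"
    and "0 < r"
    and "radon_random_variable M X"
    and "integrable M (\<lambda>\<omega>. norm (X \<omega>) powr r)"
    and "banach_subspace F"
    and "measure (distr M borel X) F = 1"
    and "admissible F"
    and "1 \<le> n"
  shows "opt_quantizers n r M X \<noteq> {}"
proof -
  have X: "X \<in> borel_measurable M" and radon: "radon_prob (distr M borel X)"
    using assms(3) by (auto simp: radon_random_variable_def)
  have "closed F"
    using assms(5) by (simp add: banach_subspace_def)
  from radon_prob_countable_dense[OF radon this assms(6)]
  obtain D where D: "countable D" "D \<subseteq> F" "AE x in distr M borel X. x \<in> closure D" .
  have AE: "AE \<omega> in M. X \<omega> \<in> closure D"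
    using D(3) X by (simp add: AE_distr_iff)
  define S where "S = {quant_err r M X \<alpha> | \<alpha>. 1 \<le> card \<alpha> \<and> card \<alpha> \<le> n}"
  have e: "opt_quant_err n r M X = Inf S"
    by (simp add: opt_quant_err_def S_def)
  have "quant_err r M X {0} \<in> S"
    using assms(8) unfolding S_def by force
  then have S_ne: "S \<noteq> {}" by blast
  have S_bdd: "bdd_below S"
    by (rule bdd_belowI[of _ 0]) (auto simp: S_def quant_err_eq)
  have "\<exists>u. (\<forall>k. u k \<in> S) \<and> u \<longlonglongrightarrow> Inf S"
    using closure_contains_Inf[OF S_ne S_bdd] unfolding closure_sequential .
  then obtain u where u: "\<And>k. u k \<in> S" "u \<longlonglongrightarrow> Inf S"
    by blast
  have "\<exists>a. u k = quant_err r M X (a ` {..<n})" for k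
  proof -
    obtain \<alpha> where \<alpha>: "u k = quant_err r M X \<alpha>" "1 \<le> card \<alpha>" "card \<alpha> \<le> n"
      using u(1)[of k] by (auto simp: S_def)
    from image_lessThan_enumeration[OF \<alpha>(2,3)] obtain a where "a ` {..<n} = \<alpha>" .
    with \<alpha>(1) show ?thesis by blast
  qed
  then obtain a where "\<And>k. u k = quant_err r M X (a k ` {..<n})"
    by metis
  then have "u = (\<lambda>k. quant_err r M X (a k ` {..<n}))"
    by (rule ext)
  with u(2) have "(\<lambda>k. quant_err r M X (a k ` {..<n})) \<longlonglongrightarrow> Inf S"
    by simp
  from exists_dominating_quantizer[OF assms(1,2) X assms(4,7) D(2,1) AE assms(8) this]
  obtain b where b: "quant_err r M X (b ` {..<n}) \<le> Inf S" .
  have "b 0 \<in> b ` {..<n}"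
    using assms(8) by auto
  then have card: "1 \<le> card (b ` {..<n})" "card (b ` {..<n}) \<le> n"
    using card_image_le[of "{..<n}" b] by (auto simp: Suc_le_eq card_gt_0_iff)
  then have "Inf S \<le> quant_err r M X (b ` {..<n})"
    by (intro cInf_lower S_bdd) (auto simp: S_def)
  with b card have "b ` {..<n} \<in> opt_quantizers n r M X"
    by (simp add: opt_quantizers_def e)
  then show ?thesis by blast
qed

end
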